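(* For zero-size items with at least three colors, there is no deterministic online algorithm for Colored Bin Packing with asymptotic competitive ratio less than $1.5$. Precisely, for every deterministic online algorithm and every integer $n>1$ there is a sequence of zero-size items using only three colors such that $\mathrm{OPT} = n$ and the algorithm uses at least $\lceil 1.5n\rceil$ bins on it.
   Context: Colored Bin Packing: items arrive as a sequence; each item has a size in $[0,1]$ and a color from a finite set $C$. A packing assigns every item to a bin of unit capacity; the items in a bin are ordered by their arrival. A packing is valid if in every bin the total size is at most $1$ and no two items that are consecutive in that bin have the same color. $\mathrm{OPT}(L)$ is the minimum number of bins in a valid packing of $L$ without reordering. An online algorithm receives items one by one, must irrevocably place each item into an existing bin (respecting validity) or a new bin before seeing the next item, and does not know future items. $\mathrm{ALG}(L)$ is the number of bins it uses. An algorithm is asymptotically $r$-competitive if $\mathrm{ALG}(L)\le r\cdot \mathrm{OPT}(L)+o(\mathrm{OPT}(L))$ for all $L$; its asymptotic competitive ratio is the infimum of such $r$. *)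

theory Defs
  imports Complex_Main "HOL-Library.Landau_Symbols" "HOL-Library.Extended_Real"
begin

datatype 'c item = Item (isize: real) (icolor: 'c)

definition cbp_items :: "'c set \<Rightarrow> 'c item set" where
  "cbp_items C = {x. 0 \<le> isize x \<and> isize x \<le> 1 \<and> icolor x \<in> C}"

definition zero_items :: "'c set \<Rightarrow> 'c item set" where
  "zero_items C = {x \<in> cbp_items C. isize x = 0}"

text \<open>A packing of \<open>L\<close> is a function \<open>f\<close> that maps the position \<open>i < length L\<close> of an item to
  the label of its bin.  Only labels that are hit count as bins, so a label that has not
  been used yet stands for a new bin.\<close>

definition bin_contents :: "'c item list \<Rightarrow> (nat \<Rightarrow> nat) \<Rightarrow> nat \<Rightarrow> 'c item list" where
  "bin_contents L f b = nths L {i. f i = b}"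

definition valid_packing :: "'c item list \<Rightarrow> (nat \<Rightarrow> nat) \<Rightarrow> bool" where
  "valid_packing L f \<longleftrightarrow>
     (\<forall>b. sum_list (map isize (bin_contents L f b)) \<le> 1 \<and>
          distinct_adj (map icolor (bin_contents L f b)))"

definition num_bins :: "'c item list \<Rightarrow> (nat \<Rightarrow> nat) \<Rightarrow> nat" where
  "num_bins L f = card (f ` {..<length L})"

definition opt :: "'c item list \<Rightarrow> nat" where
  "opt L = (LEAST k. \<exists>f. valid_packing L f \<and> num_bins L f = k)"

text \<open>A deterministic online algorithm \<open>A\<close> chooses the bin \<open>A h x\<close> of the arriving item \<open>x\<close>
  knowing only the list \<open>h\<close> of earlier items (which, \<open>A\<close> being deterministic, also determines
  its earlier decisions).\<close>

type_synonym 'c online = "'c item list \<Rightarrow> 'c item \<Rightarrow> nat"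

definition online_packing :: "'c online \<Rightarrow> 'c item list \<Rightarrow> nat \<Rightarrow> nat" where
  "online_packing A L i = A (take i L) (L ! i)"

definition online_algorithm :: "'c item set \<Rightarrow> 'c online \<Rightarrow> bool" where
  "online_algorithm X A \<longleftrightarrow> (\<forall>L \<in> lists X. valid_packing L (online_packing A L))"

definition alg :: "'c online \<Rightarrow> 'c item list \<Rightarrow> nat" where
  "alg A L = num_bins L (online_packing A L)"

definition asymp_competitive :: "'c item set \<Rightarrow> 'c online \<Rightarrow> real \<Rightarrow> bool" where
  "asymp_competitive X A r \<longleftrightarrow>
     (\<exists>g :: nat \<Rightarrow> real. g \<in> o(\<lambda>k. real k) \<and>
        (\<forall>L \<in> lists X. real (alg A L) \<le> r * real (opt L) + g (opt L)))"

text \<open>The infimum is taken in the extended reals, so that the ratio is \<open>\<infinity>\<close> if \<open>A\<close> is not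
  asymptotically \<open>r\<close>-competitive for any \<open>r\<close>.\<close>

definition asymp_ratio :: "'c item set \<Rightarrow> 'c online \<Rightarrow> ereal" where
  "asymp_ratio X A = (INF r \<in> {r. asymp_competitive X A r}. ereal r)"

text \<open>By the following monotonicity facts, a lower bound for algorithms that only have to handle
  zero-size items applies to algorithms for arbitrary items.\<close>

lemma zero_items_subset: "zero_items C \<subseteq> cbp_items C"
  by (auto simp: zero_items_def)

lemma online_algorithm_mono:
  assumes "X \<subseteq> Y" and "online_algorithm Y A"
  shows "online_algorithm X A"
  using assms(2) lists_mono[OF assms(1)] by (auto simp only: online_algorithm_def)

lemma asymp_ratio_mono:
  assumes "X \<subseteq> Y"
  shows "asymp_ratio X A \<le> asymp_ratio Y A"
proof -
  have "asymp_competitive X A r" if "asymp_competitive Y A r" for r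
    using that subsetD[OF lists_mono[OF assms]] unfolding asymp_competitive_def by meson
  then show ?thesis
    unfolding asymp_ratio_def by (intro INF_superset_mono) auto
qed

end

theory Submission imports Defs begin

text \<open>
  The discrepancy of a color \<open>c\<close> is the maximum, over all suffixes of the items seen so far
  (including the empty one), of the number of items of color \<open>c\<close> minus the number of all other
  items. It is a lower bound for the number of bins ending in \<open>c\<close>, in any packing. Conversely, if
  no discrepancy ever exceeds \<open>n\<close>, then \<open>n\<close> bins suffice for zero-size items.

  The adversary therefore keeps all discrepancies at most \<open>n\<close>. Suppose that the algorithm never
  uses \<open>3n/2\<close> bins, and take a continuation of the initial items, with black discrepancy \<open>n\<close>,
  that maximizes the number of black bins minus the black discrepancy. By maximality, from then on
  each white or red item that lowers the black discrepancy goes onto a black bin. Hence \<open>n\<close> items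
  alternating between white and red, \<open>n\<close> even, leave \<open>n/2\<close> white bins and no white discrepancy,
  and \<open>n\<close> further white items make \<open>3n/2\<close> white bins. If \<open>n\<close> is odd, the items white, red, black
  come first: the black item covers at most one of the bins of the two preceding items, so one of
  the colors white and red has a bin in advance although its discrepancy is \<open>0\<close>; the alternation
  then starts with this color and has length \<open>n - 1\<close>.
\<close>

section \<open>Discrepancies\<close>

text \<open>The recurrences rely on truncated subtraction: \<open>disc\<close> and \<open>lookahead\<close> are the maximal
  discrepancies over all suffixes and all prefixes, respectively.\<close>

definition disc :: "'c \<Rightarrow> 'c list \<Rightarrow> nat" where
  "disc c cs = foldl (\<lambda>k x. if x = c then Suc k else k - 1) 0 cs"

definition lookahead :: "'c \<Rightarrow> 'c list \<Rightarrow> nat" where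
  "lookahead c cs = foldr (\<lambda>x k. if x = c then Suc k else k - 1) cs 0"

text \<open>Ranging over all prefixes bounds the excess of each color over every contiguous block.
  This form is stable under reversal, which exchanges \<open>disc\<close> and
  \<open>lookahead\<close>.\<close>

definition disc_bounded :: "nat \<Rightarrow> 'c list \<Rightarrow> bool" where
  "disc_bounded n cs \<longleftrightarrow> (\<forall>c k. disc c (take k cs) \<le> n)"

lemma disc_Nil [simp]: "disc c [] = 0"
  by (simp add: disc_def)

lemma disc_snoc [simp]: "disc c (cs @ [x]) = (if x = c then Suc (disc c cs) else disc c cs - 1)"
  by (simp add: disc_def)

lemma lookahead_Nil [simp]: "lookahead c [] = 0"
  by (simp add: lookahead_def)

lemma lookahead_Cons [simp]:
  "lookahead c (x # cs) = (if x = c then Suc (lookahead c cs) else lookahead c cs - 1)"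
  by (simp add: lookahead_def)

lemma disc_replicate_same [simp]: "disc c (cs @ replicate k c) = disc c cs + k"
proof (induction k)
  case (Suc k)
  have "cs @ replicate (Suc k) c = (cs @ replicate k c) @ [c]"
    by (simp add: replicate_append_same)
  then show ?case
    using Suc by (simp only: disc_snoc) simp
qed simp

lemma disc_bounded_Nil [simp]: "disc_bounded n []"
  by (simp add: disc_bounded_def)

lemma disc_bounded_le: "disc_bounded n cs \<Longrightarrow> disc c cs \<le> n"
  unfolding disc_bounded_def by (metis order_refl take_all)

lemma disc_bounded_appendD: "disc_bounded n (cs @ ds) \<Longrightarrow> disc_bounded n cs"
proof -
  assume *: "disc_bounded n (cs @ ds)"
  have "take (min k (length cs)) (cs @ ds) = take k cs" for k
    by (simp add: min_def)
  then show ?thesis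
    using * unfolding disc_bounded_def by metis
qed

lemma disc_bounded_snoc: "disc_bounded n (cs @ [x]) \<longleftrightarrow> disc_bounded n cs \<and> disc x cs < n"
proof
  assume *: "disc_bounded n (cs @ [x])"
  show "disc_bounded n cs \<and> disc x cs < n"
    using disc_bounded_appendD[OF *] disc_bounded_le[OF *, of x] by simp
next
  assume *: "disc_bounded n cs \<and> disc x cs < n"
  show "disc_bounded n (cs @ [x])"
    unfolding disc_bounded_def
  proof (intro allI)
    fix c k
    show "disc c (take k (cs @ [x])) \<le> n"
    proof (cases "k \<le> length cs")
      case True
      then show ?thesis using * by (simp add: disc_bounded_def)
    next
      case False
      then have "take k (cs @ [x]) = cs @ [x]" by simp
      then show ?thesis
        using * disc_bounded_le[of n cs c] by auto
    qed
  qed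
qed

text \<open>An item raises only the discrepancy of its own color and lowers every other positive
  one. If the other is already 0, the bound on a single color suffices.\<close>

lemma disc_add_disc_le:
  assumes "disc_bounded n cs" and "c \<noteq> d"
  shows "disc c cs + disc d cs \<le> n"
  using assms(1)
proof (induction cs rule: rev_induct)
  case (snoc x cs)
  then have "disc c cs + disc d cs \<le> n" "disc x cs < n" "disc_bounded n cs"
    by (simp_all add: disc_bounded_snoc)
  then show ?case using assms(2) by auto
qed simp

text \<open>Mirror image of \<open>disc_add_disc_le\<close>, with suffixes in the role of
  prefixes.\<close>

lemma lookahead_add_lookahead_le:
  assumes "\<And>k. lookahead c (drop k cs) \<le> n" "\<And>k. lookahead d (drop k cs) \<le> n" and "c \<noteq> d"
  shows "lookahead c cs + lookahead d cs \<le> n"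
  using assms(1,2)
proof (induction cs)
  case (Cons x cs)
  have "lookahead c cs + lookahead d cs \<le> n"
    using Cons.prems[of "Suc _"] by (intro Cons.IH) simp_all
  moreover have "lookahead c (x # cs) \<le> n" "lookahead d (x # cs) \<le> n"
    using Cons.prems[of 0] by simp_all
  ultimately show ?case using assms(3) by (auto split: if_splits)
qed simp

text \<open>A suffix of \<open>cs\<close> followed by a prefix of \<open>ds\<close> is a contiguous
  block of \<open>cs @ ds\<close>. The induction moves one item at a time from \<open>ds\<close> to
  \<open>cs\<close>.\<close>

lemma disc_add_lookahead_le:
  assumes "disc_bounded n (cs @ ds)"
  shows "disc c cs + lookahead c ds \<le> n"
  using assms
proof (induction ds arbitrary: cs)
  case Nil
  then show ?case by (simp add: disc_bounded_le)
next
  case (Cons x ds)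
  have "disc c (cs @ [x]) + lookahead c ds \<le> n"
    using Cons.prems by (intro Cons.IH) simp
  \<comment> \<open>Covers the case where truncation makes the lookahead 0.\<close>
  moreover have "disc c cs \<le> n"
    using disc_bounded_le[OF disc_bounded_appendD[OF Cons.prems]] .
  ultimately show ?case by (auto split: if_splits)
qed

lemma lookahead_drop_le:
  assumes "disc_bounded n cs"
  shows "lookahead c (drop k cs) \<le> n"
  using disc_add_lookahead_le[of n "take k cs" "drop k cs" c] assms by simp

section \<open>Colorings of bins and the optimum\<close>

definition proper_packing :: "'c list \<Rightarrow> (nat \<Rightarrow> nat) \<Rightarrow> bool" where
  "proper_packing cs f \<longleftrightarrow> (\<forall>b. distinct_adj (nths cs {i. f i = b}))"

definition tops :: "'c list \<Rightarrow> (nat \<Rightarrow> nat) \<Rightarrow> 'c \<Rightarrow> nat set" where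
  "tops cs f c = {b. nths cs {i. f i = b} \<noteq> [] \<and> last (nths cs {i. f i = b}) = c}"

lemma valid_packing_zero_items:
  "valid_packing (map (Item 0) cs) f \<longleftrightarrow> proper_packing cs f"
proof -
  have "map icolor (nths (map (Item 0) cs) I) = nths cs I" for I
    by (simp add: nths_map[symmetric] comp_def)
  moreover have "sum_list (map isize (nths (map (Item 0) cs) I)) = 0" for I
    by (simp add: nths_map comp_def)
  ultimately show ?thesis
    unfolding valid_packing_def bin_contents_def proper_packing_def by simp
qed

lemma nths_fibre_snoc:
  "nths (cs @ [x]) {i. f i = b} = nths cs {i. f i = b} @ (if f (length cs) = b then [x] else [])"
  by (simp add: nths_append)

lemma nths_fibre_cong:
  assumes "\<And>i. i < length cs \<Longrightarrow> f i = g i"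
  shows "nths cs {i. f i = b} = nths cs {i. g i = b}"
  using assms by (induction cs rule: rev_induct) (simp_all add: nths_fibre_snoc)

lemma tops_cong:
  "(\<And>i. i < length cs \<Longrightarrow> f i = g i) \<Longrightarrow> tops cs f c = tops cs g c"
  using nths_fibre_cong[of cs f g] by (simp add: tops_def)

lemma proper_packing_snocD:
  assumes "proper_packing (cs @ [x]) f"
  shows "proper_packing cs f" and "f (length cs) \<notin> tops cs f x"
proof -
  have *: "distinct_adj (nths cs {i. f i = b} @ (if f (length cs) = b then [x] else []))" for b
    using assms by (simp add: proper_packing_def nths_fibre_snoc)
  show "proper_packing cs f"
    unfolding proper_packing_def using * distinct_adj_appendD1 by blast
  show "f (length cs) \<notin> tops cs f x"
    using *[of "f (length cs)"] by (auto simp: tops_def distinct_adj_append_iff)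
qed

lemma tops_snoc:
  "tops (cs @ [x]) f c = (if x = c then insert (f (length cs)) (tops cs f c)
                          else tops cs f c - {f (length cs)})"
  by (auto simp: tops_def nths_fibre_snoc)

lemma tops_subset: "tops cs f c \<subseteq> f ` {..<length cs}"
proof
  fix b assume "b \<in> tops cs f c"
  then have "set (nths cs {i. f i = b}) \<noteq> {}" by (simp add: tops_def)
  then show "b \<in> f ` {..<length cs}" by (auto simp: set_nths)
qed

lemma finite_tops [simp]: "finite (tops cs f c)"
  using tops_subset by (rule finite_subset) simp

lemma tops_disjoint: "c \<noteq> d \<Longrightarrow> tops cs f c \<inter> tops cs f d = {}"
  by (auto simp: tops_def)

lemma card_tops_le: "card (tops cs f c) \<le> num_bins (map (Item 0) cs) f"
  unfolding num_bins_def using tops_subset[of cs f c] by (simp add: card_mono)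

text \<open>An item of color \<open>c\<close> must go onto a bin not ending in \<open>c\<close> and
  so adds a bin to \<open>tops\<close>; any other item removes at most one.\<close>

lemma disc_le_card_tops:
  assumes "proper_packing cs f"
  shows "disc c cs \<le> card (tops cs f c)"
  using assms
proof (induction cs rule: rev_induct)
  case (snoc x cs)
  have IH: "disc c cs \<le> card (tops cs f c)"
    using snoc.IH proper_packing_snocD(1)[OF snoc.prems] .
  show ?case
    using IH proper_packing_snocD(2)[OF snoc.prems]
    by (auto simp: tops_snoc card_insert_if card_Diff_singleton_if)
qed simp

text \<open>A bin is chosen so that, for every color \<open>c\<close>, the bins that do not end in \<open>c\<close> remain
  sufficient for the lookahead of \<open>c\<close>. The choice is never forced in two ways at once because the
  lookaheads of two distinct colors add up to at most \<open>n\<close>.\<close>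

lemma greedy_packing:
  fixes st :: "nat \<Rightarrow> 'c option"
  assumes "\<And>c k. lookahead c (drop k cs) \<le> n"
    and "\<And>c. card {b. b < n \<and> st b = Some c} + lookahead c cs \<le> n"
  shows "\<exists>f. (\<forall>i < length cs. f i < n) \<and>
    (\<forall>b. distinct_adj (case_option [] (\<lambda>c. [c]) (st b) @ nths cs {i. f i = b}))"
  using assms
proof (induction cs arbitrary: st)
  case Nil
  show ?case by (auto split: option.splits)
next
  case (Cons x cs)
  define N where "N c = {b. b < n \<and> st b = Some c}" for c
  have fin: "finite (N c)" for c by (simp add: N_def)
  have N_le: "card (N c) + lookahead c (x # cs) \<le> n" for c
    using Cons.prems(2) by (simp add: N_def)
  have drop: "lookahead c (drop k cs) \<le> n" for c k
    using Cons.prems(1)[of c "Suc k"] by simp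
  have pair: "lookahead c cs + lookahead d cs \<le> n" if "c \<noteq> d" for c d
    using that drop by (intro lookahead_add_lookahead_le)
  have disj: "card (N c) + card (N d) \<le> n" if "c \<noteq> d" for c d
  proof -
    have "card (N c) + card (N d) = card (N c \<union> N d)"
      using that fin by (subst card_Un_disjoint) (auto simp: N_def)
    also have "\<dots> \<le> card {..<n}"
      by (intro card_mono) (auto simp: N_def)
    finally show ?thesis by simp
  qed
  \<comment> \<open>\<open>st b\<close> is the current last color of bin \<open>b\<close>,
    \<open>None\<close> if it is empty. The bin \<open>a\<close> must accept \<open>x\<close> and
    end in every color whose invariant fails unless one of its bins is covered.\<close>
  have "\<exists>a<n. st a \<noteq> Some x \<and>
    (\<forall>c. c \<noteq> x \<longrightarrow> card (N c) + lookahead c cs > n \<longrightarrow> st a = Some c)"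
  proof (cases "\<exists>d. d \<noteq> x \<and> card (N d) + lookahead d cs > n")
    case True
    then obtain d where d: "d \<noteq> x" "card (N d) + lookahead d cs > n" by blast
    have "card (N d) \<noteq> 0" using d(2) drop[of d 0] by auto
    then obtain a where a: "a \<in> N d" by fastforce
    have "st a = Some c" if c: "c \<noteq> x" "card (N c) + lookahead c cs > n" for c
    proof -
      \<comment> \<open>Two distinct critical colors would give a total above \<open>2 * n\<close>,
        but \<open>disj\<close> and \<open>pair\<close> bound it by \<open>n + n\<close>.\<close>
      have "c = d" using disj[of c d] pair[of c d] c d by linarith
      then show ?thesis using a by (simp add: N_def)
    qed
    moreover have "a < n" "st a \<noteq> Some x" using a d(1) by (simp_all add: N_def)
    ultimately show ?thesis by blast
  next
    case False
    \<comment> \<open>The lookahead of \<open>x\<close> counts the arriving item, so it is at least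
      1.\<close>
    have "card (N x) < n" using N_le[of x] by simp
    then have "\<exists>a\<in>{..<n}. a \<notin> N x"
      by (metis card_lessThan card_mono fin not_less subsetI)
    then obtain a where "a < n" "st a \<noteq> Some x" by (auto simp: N_def)
    then show ?thesis using False by blast
  qed
  then obtain a where a: "a < n" "st a \<noteq> Some x"
    "\<And>c. c \<noteq> x \<Longrightarrow> card (N c) + lookahead c cs > n \<Longrightarrow> st a = Some c" by blast
  define st' where "st' = st(a := Some x)"
  have "card {b. b < n \<and> st' b = Some c} + lookahead c cs \<le> n" for c
  proof (cases "c = x")
    case True
    then have "{b. b < n \<and> st' b = Some c} = insert a (N c)"
      using a by (auto simp: st'_def N_def)
    then have "card {b. b < n \<and> st' b = Some c} \<le> Suc (card (N c))"
      by (simp add: card_insert_le_m1 card_insert_if fin)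
    then show ?thesis using N_le[of c] True by simp
  next
    case False
    then have eq: "{b. b < n \<and> st' b = Some c} = N c - {a}"
      by (auto simp: st'_def N_def)
    show ?thesis
    proof (cases "card (N c) + lookahead c cs > n")
      case True
      then have "a \<in> N c" using a False by (simp add: N_def)
      moreover from this have "card (N c) > 0" using fin card_gt_0_iff by blast
      ultimately show ?thesis
        using N_le[of c] False eq by (simp add: card_Diff_singleton_if)
    next
      case False
      then show ?thesis unfolding eq using card_Diff1_le[of "N c" a] by linarith
    qed
  qed
  then obtain f where f: "\<And>i. i < length cs \<Longrightarrow> f i < n"
    "\<And>b. distinct_adj (case_option [] (\<lambda>c. [c]) (st' b) @ nths cs {i. f i = b})"
    using Cons.IH[of st'] drop by blast
  have "distinct_adj (case_option [] (\<lambda>c. [c]) (st b) @ nths (x # cs) {i. case_nat a f i = b})" for b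
    using f(2)[of b] a(2)
    by (auto simp: st'_def nths_Cons distinct_adj_Cons split: option.splits if_splits)
  moreover have "case_nat a f i < n" if "i < length (x # cs)" for i
    using that a(1) f(1) by (cases i) auto
  ultimately show ?case by (intro exI[of _ "case_nat a f"]) blast
qed

lemma ex_proper_packing:
  assumes "disc_bounded n cs"
  obtains f where "\<And>i. i < length cs \<Longrightarrow> f i < n" and "proper_packing cs f"
proof -
  have "lookahead c cs \<le> n" for c
    using lookahead_drop_le[OF assms, of c 0] by simp
  then show thesis
    using that greedy_packing[of cs n "\<lambda>_. None"] lookahead_drop_le[OF assms]
    by (auto simp: proper_packing_def)
qed

text \<open>After \<open>cs\<close>, every valid packing already has \<open>n\<close> bins ending in
  \<open>c\<close>; the greedy packing shows that \<open>ds\<close> needs no more.\<close>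

lemma opt_zero_items_eq:
  assumes "disc_bounded n (cs @ ds)" and "disc c cs = n"
  shows "opt (map (Item 0) (cs @ ds)) = n"
  unfolding opt_def
proof (rule Least_equality)
  let ?L = "map (Item 0) (cs @ ds)"
  have lower: "n \<le> num_bins ?L f" if "valid_packing ?L f" for f
  proof -
    have "proper_packing (cs @ ds) f" using that by (simp only: valid_packing_zero_items)
    then have "proper_packing cs f"
      unfolding proper_packing_def nths_append using distinct_adj_appendD1 by blast
    then have "n \<le> card (tops cs f c)" using disc_le_card_tops[of cs f c] assms(2) by simp
    also have "\<dots> \<le> num_bins (map (Item 0) cs) f" by (rule card_tops_le)
    also have "\<dots> \<le> num_bins ?L f"
      unfolding num_bins_def by (intro card_mono) auto
    finally show ?thesis .
  qed
  obtain f where f: "\<And>i. i < length (cs @ ds) \<Longrightarrow> f i < n" "proper_packing (cs @ ds) f"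
    using ex_proper_packing[OF assms(1)] by blast
  have "num_bins ?L f \<le> card {..<n}"
    unfolding num_bins_def using f(1) by (intro card_mono) auto
  moreover have "valid_packing ?L f" using f(2) by (simp only: valid_packing_zero_items)
  ultimately show "\<exists>f. valid_packing ?L f \<and> num_bins ?L f = n"
    using lower[of f] by (intro exI[of _ f]) simp
  show "n \<le> k" if "\<exists>f. valid_packing ?L f \<and> num_bins ?L f = k" for k
    using that lower by blast
qed

section \<open>The adversary\<close>

definition online_tops :: "'c online \<Rightarrow> 'c list \<Rightarrow> 'c \<Rightarrow> nat set" where
  "online_tops A cs c = tops cs (online_packing A (map (Item 0) cs)) c"

lemma online_packing_append:
  "i < length L \<Longrightarrow> online_packing A (L @ M) i = online_packing A L i"
  by (simp add: online_packing_def nth_append)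

lemma online_packing_snoc: "online_packing A (L @ [x]) (length L) = A L x"
  by (simp add: online_packing_def)

lemma zero_items_lists:
  assumes "set cs \<subseteq> C"
  shows "map (Item 0) cs \<in> lists (zero_items C)"
proof -
  have "Item 0 c \<in> zero_items C" if "c \<in> set cs" for c
    using that assms by (simp add: zero_items_def cbp_items_def subset_iff)
  then show ?thesis by auto
qed

lemma online_proper_packing:
  assumes "online_algorithm (zero_items C) A" and "set cs \<subseteq> C"
  shows "proper_packing cs (online_packing A (map (Item 0) cs))"
proof -
  have "valid_packing (map (Item 0) cs) (online_packing A (map (Item 0) cs))"
    using assms(1) zero_items_lists[OF assms(2)] unfolding online_algorithm_def by blast
  then show ?thesis by (simp only: valid_packing_zero_items)
qed

lemma online_tops_snoc:
  "online_tops A (cs @ [x]) c =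
    (if x = c then insert (A (map (Item 0) cs) (Item 0 x)) (online_tops A cs c)
     else online_tops A cs c - {A (map (Item 0) cs) (Item 0 x)})"
proof -
  let ?f = "online_packing A (map (Item 0) (cs @ [x]))"
  have "tops cs ?f c = online_tops A cs c"
    unfolding online_tops_def by (rule tops_cong) (simp add: online_packing_append)
  moreover have "?f (length cs) = A (map (Item 0) cs) (Item 0 x)"
    using online_packing_snoc[of A "map (Item 0) cs" "Item 0 x"] by simp
  ultimately show ?thesis
    by (simp only: online_tops_def[of A "cs @ [x]"] tops_snoc)
qed

lemma online_tops_fresh:
  assumes "online_algorithm (zero_items C) A" and "set (cs @ [x]) \<subseteq> C"
  shows "A (map (Item 0) cs) (Item 0 x) \<notin> online_tops A cs x"
proof -
  let ?f = "online_packing A (map (Item 0) (cs @ [x]))"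
  have "?f (length cs) \<notin> tops cs ?f x"
    using assms by (intro proper_packing_snocD(2) online_proper_packing)
  moreover have "tops cs ?f x = online_tops A cs x"
    unfolding online_tops_def by (rule tops_cong) (simp add: online_packing_append)
  ultimately show ?thesis
    using online_packing_snoc[of A "map (Item 0) cs" "Item 0 x"] by simp
qed

lemma finite_online_tops [simp]: "finite (online_tops A cs c)"
  by (simp add: online_tops_def)

lemma online_tops_disjoint: "c \<noteq> d \<Longrightarrow> online_tops A cs c \<inter> online_tops A cs d = {}"
  by (simp add: online_tops_def tops_disjoint)

lemma card_online_tops_le_alg: "card (online_tops A cs c) \<le> alg A (map (Item 0) cs)"
  by (simp add: online_tops_def alg_def card_tops_le)

text \<open>The assumptions of the locale are contradictory. The initial white and red items only ensure
  that all three colors occur.\<close>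

locale three_color_game =
  fixes C :: "'c set" and A :: "'c online" and n :: nat and black white red :: 'c
  assumes online: "online_algorithm (zero_items C) A"
    and colors: "{black, white, red} \<subseteq> C"
    and distinct: "black \<noteq> white" "black \<noteq> red" "white \<noteq> red"
    and n_gt_1: "n > 1"
    and few_bins: "\<And>ds c. set ds \<subseteq> {black, white, red} \<Longrightarrow>
      disc_bounded n ([white, red] @ replicate n black @ ds) \<Longrightarrow>
      2 * card (online_tops A ([white, red] @ replicate n black @ ds) c) < 3 * n"
begin

definition N :: "'c \<Rightarrow> 'c list \<Rightarrow> nat" where
  "N c cs = card (online_tops A cs c)"

text \<open>The fixed beginning has black discrepancy \<open>n\<close> and the bound allows no more,
  so all these sequences have optimum \<open>n\<close>.\<close>

definition play :: "'c list \<Rightarrow> bool" where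
  "play cs \<longleftrightarrow> disc_bounded n cs \<and>
    (\<exists>ds. cs = [white, red] @ replicate n black @ ds \<and> set ds \<subseteq> {black, white, red})"

lemma play_bounded: "play cs \<Longrightarrow> disc_bounded n cs"
  by (simp add: play_def)

lemma play_colors: "play cs \<Longrightarrow> set cs \<subseteq> C"
  using colors by (auto simp: play_def)

lemma play_few_bins: "play cs \<Longrightarrow> 2 * N c cs < 3 * n"
  using few_bins by (auto simp: play_def N_def)

lemma play_snoc:
  assumes "play cs" and "c \<in> {black, white, red}" and "disc c cs < n"
  shows "play (cs @ [c])"
proof -
  obtain ds where "cs = [white, red] @ replicate n black @ ds" "set ds \<subseteq> {black, white, red}"
    using assms(1) by (auto simp: play_def)
  then have "cs @ [c] = [white, red] @ replicate n black @ (ds @ [c])"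
      "set (ds @ [c]) \<subseteq> {black, white, red}"
    using assms(2) by auto
  then show ?thesis
    using assms(1,3) unfolding play_def disc_bounded_snoc by blast
qed

lemma N_snoc_same:
  assumes "play cs" and "c \<in> {black, white, red}"
  shows "N c (cs @ [c]) = Suc (N c cs)"
proof -
  have "A (map (Item 0) cs) (Item 0 c) \<notin> online_tops A cs c"
    using assms play_colors[of cs] colors by (intro online_tops_fresh[OF online]) auto
  then show ?thesis by (simp add: N_def online_tops_snoc)
qed

text \<open>The new item covers at most one bin, and that bin ended in only one color.\<close>

lemma N_snoc_other:
  assumes "x \<noteq> c" and "x \<noteq> d" and "c \<noteq> d"
  shows "N c cs + N d cs \<le> N c (cs @ [x]) + N d (cs @ [x]) + 1"
proof -
  let ?a = "A (map (Item 0) cs) (Item 0 x)"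
  have "N c cs + N d cs = card (online_tops A cs c \<union> online_tops A cs d)"
    unfolding N_def using online_tops_disjoint[OF assms(3)] by (subst card_Un_disjoint) auto
  also have "\<dots> \<le> card (insert ?a (online_tops A (cs @ [x]) c \<union> online_tops A (cs @ [x]) d))"
    using assms by (intro card_mono) (auto simp: online_tops_snoc)
  also have "\<dots> \<le> card (online_tops A (cs @ [x]) c \<union> online_tops A (cs @ [x]) d) + 1"
    by (simp add: card_insert_if)
  also have "\<dots> \<le> N c (cs @ [x]) + N d (cs @ [x]) + 1"
    unfolding N_def using card_Un_le by auto
  finally show ?thesis .
qed

lemma N_snoc_mono: "x \<noteq> c \<Longrightarrow> N c (cs @ [x]) \<le> N c cs"
  unfolding N_def by (auto simp: online_tops_snoc intro: card_mono)

lemma disc_le_N: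
  assumes "play cs"
  shows "disc c cs \<le> N c cs"
  unfolding N_def online_tops_def
  using online_proper_packing[OF online play_colors[OF assms]] by (rule disc_le_card_tops)

lemma play_replicate:
  assumes "play cs" and "c \<in> {black, white, red}" and "disc c cs + k \<le> n"
  shows "play (cs @ replicate k c) \<and> N c (cs @ replicate k c) = N c cs + k"
  using assms(3)
proof (induction k)
  case (Suc k)
  have eq: "cs @ replicate (Suc k) c = (cs @ replicate k c) @ [c]"
    by (simp add: replicate_append_same)
  have IH: "play (cs @ replicate k c)" "N c (cs @ replicate k c) = N c cs + k"
    using Suc by simp_all
  have "disc c (cs @ replicate k c) < n" using Suc.prems by simp
  from play_snoc[OF IH(1) assms(2) this] N_snoc_same[OF IH(1) assms(2)]
  show ?case unfolding eq IH(2) by simp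
qed (use assms(1) in simp)

lemma play_start: "play ([white, red] @ replicate n black)"
proof -
  have "disc_bounded n (([] @ [white]) @ [red])"
    unfolding disc_bounded_snoc disc_snoc using n_gt_1 by simp
  then have wr: "disc_bounded n [white, red]" by simp
  have "disc black [white, red] = 0"
    using distinct by (simp add: disc_def)
  then have "k \<le> n \<Longrightarrow> disc_bounded n ([white, red] @ replicate k black)" for k
  proof (induction k)
    case 0
    then show ?case using wr by simp
  next
    case (Suc k)
    have eq: "[white, red] @ replicate (Suc k) black = ([white, red] @ replicate k black) @ [black]"
      by (simp add: replicate_append_same)
    show ?case
      using Suc unfolding eq disc_bounded_snoc disc_replicate_same by simp
  qed
  then show ?thesis by (auto simp: play_def)
qed

text \<open>The surplus of black bins over the black discrepancy is maximal; sums replace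
  differences because subtraction truncates.\<close>

definition tight :: "'c list \<Rightarrow> bool" where
  "tight cs \<longleftrightarrow> play cs \<and>
    (\<forall>ds. play ds \<longrightarrow> N black ds + disc black cs \<le> N black cs + disc black ds)"

lemma tight_play: "tight cs \<Longrightarrow> play cs"
  by (simp add: tight_def)

lemma tight_transfer:
  assumes "tight cs" and "play ds"
    and "N black ds + disc black cs \<ge> N black cs + disc black ds"
  shows "tight ds"
  unfolding tight_def
proof (intro conjI allI impI)
  fix es assume "play es"
  then have "N black es + disc black cs \<le> N black cs + disc black es"
    using assms(1) by (simp add: tight_def)
  then show "N black es + disc black ds \<le> N black ds + disc black es"
    using assms(3) by linarith
qed (fact assms(2))

text \<open>A maximal surplus exists because \<open>few_bins\<close> bounds it. Appending black
  items raises both counts equally, hence preserves the surplus, until the black discrepancy is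
  \<open>n\<close> and leaves no room for the others.\<close>

lemma tight_full:
  obtains cs where "tight cs" and "disc black cs = n" and "disc white cs = 0" and "disc red cs = 0"
proof -
  let ?P = "\<lambda>k. \<exists>cs. play cs \<and> N black cs - disc black cs = k"
  have ex: "?P (N black ([white, red] @ replicate n black)
      - disc black ([white, red] @ replicate n black))"
    using play_start by blast
  have "k \<le> 3 * n" if "?P k" for k
    using that play_few_bins[of _ black] by fastforce
  then have "?P (Greatest ?P)" and max: "\<And>k. ?P k \<Longrightarrow> k \<le> Greatest ?P"
    using GreatestI_nat[of ?P, OF ex] Greatest_le_nat[of ?P] by blast+
  then obtain cs where cs: "play cs" "N black cs - disc black cs = Greatest ?P" by blast
  have "N black ds - disc black ds \<le> N black cs - disc black cs" if "play ds" for ds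
    using max[of "N black ds - disc black ds"] that cs(2) by auto
  \<comment> \<open>By \<open>disc_le_N\<close>, the truncated differences are true
    differences.\<close>
  then have "N black ds + disc black cs \<le> N black cs + disc black ds" if "play ds" for ds
    using that disc_le_N[OF that, of black] disc_le_N[OF cs(1), of black] by force
  then have tight: "tight cs" using cs(1) by (simp add: tight_def)
  define k where "k = n - disc black cs"
  have k: "disc black cs + k = n"
    using disc_bounded_le[OF play_bounded[OF cs(1)], of black] by (simp add: k_def)
  let ?ds = "cs @ replicate k black"
  have ds: "play ?ds" "N black ?ds = N black cs + k"
    using play_replicate[OF cs(1), of black k] k by simp_all
  have full: "disc black ?ds = n" using k by simp
  have "disc c ?ds = 0" if "c \<noteq> black" for c
    using disc_add_disc_le[OF play_bounded[OF ds(1)] that] full by linarith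
  moreover have "tight ?ds"
    using tight ds(1) by (rule tight_transfer) (use ds(2) in simp)
  ultimately show thesis using that[of ?ds] full distinct by metis
qed

lemma tight_snoc_black:
  assumes "tight cs" and "disc black cs < n"
  shows "tight (cs @ [black])"
  using assms(1) play_snoc[OF tight_play[OF assms(1)] _ assms(2)]
  by (rule tight_transfer) (use N_snoc_same[OF tight_play[OF assms(1)], of black] in simp_all)

text \<open>The black discrepancy drops by one. If no black bin were covered, the surplus would
  exceed its maximum; hence the item covers a black bin and no bin of color
  \<open>y\<close>.\<close>

lemma tight_snoc:
  assumes "tight cs" and "{x, y} = {white, red}" and "disc black cs > 0" and "disc x cs < n"
  shows "tight (cs @ [x])" and "N x (cs @ [x]) = Suc (N x cs)" and "N y (cs @ [x]) \<ge> N y cs"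
proof -
  have neq: "x \<noteq> black" "y \<noteq> black" "x \<noteq> y" "x \<in> {black, white, red}"
    using assms(2) distinct by (auto simp: doubleton_eq_iff)
  have play: "play (cs @ [x])"
    using play_snoc[OF tight_play[OF assms(1)] neq(4) assms(4)] .
  have drop: "N black cs + N y cs \<le> N black (cs @ [x]) + N y (cs @ [x]) + 1"
    using neq by (intro N_snoc_other) auto
  have "N y (cs @ [x]) \<le> N y cs" using neq(3) by (rule N_snoc_mono)
  then show "tight (cs @ [x])"
    using drop neq(1) assms(3) by (intro tight_transfer[OF assms(1) play]) simp
  have "N black (cs @ [x]) + disc black cs \<le> N black cs + disc black (cs @ [x])"
    using assms(1) play unfolding tight_def by blast
  then show "N y (cs @ [x]) \<ge> N y cs"
    using drop neq(1) assms(3) by simp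
  show "N x (cs @ [x]) = Suc (N x cs)"
    using tight_play[OF assms(1)] neq(4) by (rule N_snoc_same)
qed

text \<open>Each pair \<open>x\<close>, \<open>y\<close> uses up two units of black discrepancy and
  gains a bin ending in \<open>x\<close>, which the \<open>y\<close> item does not cover. The bound
  1 for \<open>y\<close> admits both the start and the later rounds, where the discrepancy of
  \<open>y\<close> is exactly 1.\<close>

lemma tight_alternate:
  assumes "{x, y} = {white, red}"
    and "tight cs" and "disc x cs = 0" and "disc y cs \<le> 1" and "disc black cs = 2 * m"
  shows "\<exists>ds. play ds \<and> disc x ds = 0 \<and> N x ds \<ge> N x cs + m"
  using assms(2-)
proof (induction m arbitrary: cs)
  case 0
  then show ?case using tight_play by auto
next
  case (Suc m)
  have neq: "x \<noteq> black" "y \<noteq> black" "x \<noteq> y" and yx: "{y, x} = {white, red}"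
    using assms(1) distinct by (auto simp: doubleton_eq_iff)
  define u where "u = cs @ [x]"
  define v where "v = u @ [y]"
  have u: "tight u" "N x u = Suc (N x cs)"
    using tight_snoc[OF Suc.prems(1) assms(1)] Suc.prems n_gt_1 by (simp_all add: u_def)
  have disc_u: "disc x u = 1" "disc y u = 0" "disc black u = Suc (2 * m)"
    using Suc.prems neq by (simp_all add: u_def)
  have v: "tight v" "N x v \<ge> N x u"
    using tight_snoc[OF u(1) yx] disc_u n_gt_1 by (simp_all add: v_def)
  have "disc x v = 0" "disc black v = 2 * m" "disc y v = 1"
    using disc_u neq by (simp_all add: v_def)
  then obtain ds where "play ds" "disc x ds = 0" "N x ds \<ge> N x v + m"
    using Suc.IH[OF v(1)] by auto
  then show ?case using u(2) v(2) by (intro exI[of _ ds]) simp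
qed

lemma contradiction: False
proof -
  \<comment> \<open>With discrepancy 0 and at least \<open>n/2\<close> bins for \<open>x\<close>,
    \<open>n\<close> more items of color \<open>x\<close> make \<open>3n/2\<close> bins ending in
    \<open>x\<close>.\<close>
  have win: False
    if h: "{x, y} = {white, red}" "tight cs" "disc x cs = 0" "disc y cs \<le> 1" "disc black cs = 2 * m"
      "2 * (N x cs + m) \<ge> n" for x y cs m
  proof -
    obtain ds where ds: "play ds" "disc x ds = 0" "N x ds \<ge> N x cs + m"
      using tight_alternate[OF h(1-5)] by blast
    have "x \<in> {black, white, red}" using h(1) by auto
    then have *: "play (ds @ replicate n x)" "N x (ds @ replicate n x) = N x ds + n"
      using play_replicate[OF ds(1), of x n] ds(2) by simp_all
    show False
      using play_few_bins[OF *(1), of x] ds(3) h(6) unfolding *(2) by simp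
  qed
  obtain cs where cs: "tight cs" "disc black cs = n" "disc white cs = 0" "disc red cs = 0"
    by (rule tight_full)
  show False
  proof (cases "even n")
    case True
    then show False
      using win[of white red cs "n div 2"] cs by simp
  next
    case False
    then obtain m where m: "n = 2 * m + 1" by (rule oddE)
    then have n: "n \<ge> 3" using n_gt_1 by simp
    define u where "u = cs @ [white]"
    define v where "v = u @ [red]"
    define z where "z = v @ [black]"
    have u: "tight u" "N white u = Suc (N white cs)"
      using tight_snoc[OF cs(1), of white red] cs n by (simp_all add: u_def)
    have disc_u: "disc black u = n - 1" "disc white u = 1" "disc red u = 0"
      using cs distinct by (auto simp: u_def)
    have v: "tight v" "N red v = Suc (N red u)" "N white v \<ge> N white u"
      using tight_snoc[OF u(1), of red white] disc_u n by (auto simp: v_def)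
    have disc_v: "disc black v = n - 2" "disc white v = 0" "disc red v = 1"
      using disc_u distinct by (auto simp: v_def)
    have z: "tight z"
      using tight_snoc_black[OF v(1)] disc_v n by (simp add: z_def)
    have disc_z: "disc black z = 2 * m" "disc white z = 0" "disc red z = 0"
      using disc_v distinct m n by (auto simp: z_def)
    \<comment> \<open>Before the black item there is at least one white and one red bin, so at least
      one of them survives, while both discrepancies become 0.\<close>
    have "N white v + N red v \<le> N white z + N red z + 1"
      unfolding z_def using distinct by (intro N_snoc_other) auto
    then consider "N white z \<ge> 1" | "N red z \<ge> 1"
      using u(2) v(2,3) by linarith
    then show False
    proof cases
      case 1
      then show False
        using win[of white red z m] z disc_z m by auto
    next
      case 2
      then show False
        using win[of red white z m] z disc_z m by auto
    qed
  qed
qed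

end

section \<open>From the game to the competitive ratio\<close>

lemma adversary_forces_bins:
  assumes "online_algorithm (zero_items C) A" and "{black, white, red} \<subseteq> C"
    and "black \<noteq> white" "black \<noteq> red" "white \<noteq> red" and "n > 1"
  shows "\<exists>L \<in> lists (zero_items C).
    icolor ` set L = {black, white, red} \<and> opt L = n \<and> 3 * n \<le> 2 * alg A L"
proof -
  have "\<not> three_color_game C A n black white red"
    using three_color_game.contradiction[of C A n black white red] by blast
  \<comment> \<open>All other locale assumptions hold, so it is \<open>few_bins\<close> that fails;
    its counterexample is the hard sequence.\<close>
  then obtain ds c where ds: "set ds \<subseteq> {black, white, red}"
    "disc_bounded n ([white, red] @ replicate n black @ ds)"
    "3 * n \<le> 2 * card (online_tops A ([white, red] @ replicate n black @ ds) c)"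
    using assms unfolding three_color_game_def by (meson not_less)
  define cs where "cs = [white, red] @ replicate n black"
  have disc: "disc black cs = n"
    using disc_replicate_same[of black "[white, red]" n] assms(3,4)
    by (simp add: cs_def disc_def)
  have set: "set (cs @ ds) = {black, white, red}"
    using ds(1) assms(6) by (auto simp: cs_def)
  have bounded: "disc_bounded n (cs @ ds)" using ds(2) by (simp add: cs_def)
  show ?thesis
  proof (intro bexI[of _ "map (Item 0) (cs @ ds)"] conjI)
    show "icolor ` set (map (Item 0) (cs @ ds)) = {black, white, red}"
      using set by (simp only: set_map image_image) simp
    show "opt (map (Item 0) (cs @ ds)) = n"
      using bounded disc by (rule opt_zero_items_eq)
    show "3 * n \<le> 2 * alg A (map (Item 0) (cs @ ds))"
      using ds(3) card_online_tops_le_alg[of A "cs @ ds" c] unfolding cs_def by simp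
    have "set (cs @ ds) \<subseteq> C" using set assms(2) by blast
    then show "map (Item 0) (cs @ ds) \<in> lists (zero_items C)"
      by (rule zero_items_lists)
  qed
qed

lemma asymp_ratio_ge:
  assumes "\<And>n. n > 1 \<Longrightarrow> \<exists>L \<in> lists X. opt L = n \<and> a * real n \<le> real (alg A L)"
  shows "asymp_ratio X A \<ge> ereal a"
  unfolding asymp_ratio_def
proof (rule INF_greatest)
  fix r assume "r \<in> {r. asymp_competitive X A r}"
  then obtain g :: "nat \<Rightarrow> real" where g: "g \<in> o(\<lambda>k. real k)"
    "\<And>L. L \<in> lists X \<Longrightarrow> real (alg A L) \<le> r * real (opt L) + g (opt L)"
    unfolding asymp_competitive_def by blast
  have "a \<le> r"
  proof (rule ccontr)
    assume "\<not> a \<le> r"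
    \<comment> \<open>For large optima, \<open>g\<close> takes up at most half of the gap between
      \<open>r\<close> and \<open>a\<close>. Every value above 1 occurs as an optimum, so a large
      enough one is available.\<close>
    then have "(a - r) / 2 > 0" by simp
    from landau_o.smallD[OF g(1) this]
    have "eventually (\<lambda>k. \<bar>g k\<bar> \<le> (a - r) / 2 * real k \<and> k > 1) sequentially"
      by (intro eventually_conj eventually_gt_at_top) simp
    then obtain k where k: "\<bar>g k\<bar> \<le> (a - r) / 2 * real k" "k > 1"
      by (metis (no_types, lifting) eventually_sequentially order_refl)
    obtain L where L: "L \<in> lists X" "opt L = k" "a * real k \<le> real (alg A L)"
      using assms[OF k(2)] by blast
    have "a * real k \<le> r * real k + (a - r) / 2 * real k"
      using g(2)[OF L(1)] k(1) L(3) unfolding L(2) by linarith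
    then have "(a - r) / 2 * real k \<le> 0" by (simp add: field_simps)
    then show False
      using \<open>(a - r) / 2 > 0\<close> k(2) by (simp add: mult_le_0_iff)
  qed
  then show "ereal a \<le> ereal r" by simp
qed

theorem theorem3p1:
  fixes C :: "'c set"
  assumes "finite C" and "card C \<ge> 3"
  shows "(\<nexists>A. online_algorithm (zero_items C) A \<and> asymp_ratio (zero_items C) A < ereal (3 / 2)) \<and>
    (\<forall>A. online_algorithm (zero_items C) A \<longrightarrow>
      (\<forall>n::nat. n > 1 \<longrightarrow>
        (\<exists>L \<in> lists (zero_items C).
           card (icolor ` set L) = 3 \<and>
           opt L = n \<and>
           int (alg A L) \<ge> \<lceil>3 / 2 * real n\<rceil>)))"
proof -
  obtain D where "D \<subseteq> C" "card D = 3"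
    using assms(2) obtain_subset_with_card_n by metis
  then obtain black white red where D: "{black, white, red} \<subseteq> C"
    "black \<noteq> white" "black \<noteq> red" "white \<noteq> red"
    by (auto simp: card_3_iff)
  have forced: "\<exists>L \<in> lists (zero_items C).
      card (icolor ` set L) = 3 \<and> opt L = n \<and> 3 / 2 * real n \<le> real (alg A L)"
    if A: "online_algorithm (zero_items C) A" and n: "n > 1" for A n
  proof -
    obtain L where L: "L \<in> lists (zero_items C)" "icolor ` set L = {black, white, red}"
      "opt L = n" "3 * n \<le> 2 * alg A L"
      using adversary_forces_bins[OF A D n] by blast
    have "3 / 2 * real n \<le> real (alg A L)" using L(4) by linarith
    moreover have "card (icolor ` set L) = 3" using L(2) D by simp
    ultimately show ?thesis using L by blast
  qed
  have "\<not> asymp_ratio (zero_items C) A < ereal (3 / 2)"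
    if "online_algorithm (zero_items C) A" for A
    unfolding not_less using forced[OF that] by (intro asymp_ratio_ge) blast
  moreover have "\<exists>L \<in> lists (zero_items C). card (icolor ` set L) = 3 \<and> opt L = n \<and>
      int (alg A L) \<ge> \<lceil>3 / 2 * real n\<rceil>"
    if "online_algorithm (zero_items C) A" "n > 1" for A n
    using forced[OF that] by (simp add: ceiling_le_iff)
  ultimately show ?thesis by blast
qed

end
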